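(* For $\beta\in\mathbb R$ let $\Phi^C_\beta:\mathcal M_3\to\mathcal M_3$ be the linear map $\Phi^C_\beta(\rho)=S_1(\rho)-\beta\,(S_2(\rho)-S_3(\rho))$, where $$S_1(\rho)=\sum_{i=1}^3\Big(A_i\rho A_i^\dagger-\tfrac12\{A_iA_i^\dagger,\rho\}\Big),\quad S_2(\rho)=\sum_{j=1}^3\Big(B_j\rho B_j^\dagger-\tfrac12\{B_jB_j^\dagger,\rho\}\Big),\quad S_3(\rho)=\sum_{k=1}^3\Big(C_k\rho C_k^\dagger-\tfrac12\{C_kC_k^\dagger,\rho\}\Big),$$ with $A_1=|1\rangle\langle2|$, $A_2=|2\rangle\langle3|$, $A_3=|3\rangle\langle1|$; $B_j=|j\rangle\langle j|$ for $j=1,2,3$; $C_1=|1\rangle\langle1|-|2\rangle\langle2|$, $C_2=|2\rangle\langle2|-|3\rangle\langle3|$, $C_3=|3\rangle\langle3|-|1\rangle\langle1|$. Let $\Phi^C_{F,\beta}=\mathcal I+\tfrac12\Phi^C_\beta$. Then: (i) for $\beta=1$, $\Phi^C_{F,1}$ is, up to the factor $\tfrac12$, the Choi map: $$\Phi^C_{F,1}(\rho)=\frac12\begin{bmatrix}\rho_{11}+\rho_{22}&-\rho_{12}&-\rho_{13}\\-\rho_{21}&\rho_{22}+\rho_{33}&-\rho_{23}\\-\rho_{31}&-\rho_{32}&\rho_{33}+\rho_{11}\end{bmatrix};$$ (ii) $\Phi^C_{F,\beta}$ is positive for $0\le\beta\le1$; (iii) $\Phi^C_{F,\beta}$ is completely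 positive for $0\le\beta\le\tfrac34$.
   Context: $\mathcal M_3$ is the algebra of $3\times3$ complex matrices, $|1\rangle,|2\rangle,|3\rangle$ is the standard basis of $\mathbb C^3$, $\rho_{jk}=\langle j|\rho|k\rangle$, $\{X,Y\}=XY+YX$, and $\mathcal I$ is the identity map on $\mathcal M_3$. A linear map on $\mathcal M_3$ is positive if it preserves positive semidefiniteness, and completely positive if all its amplifications $\mathrm{id}_n\otimes\Phi$ are positive. *)

theory Defs
  imports "Jordan_Normal_Form.Schur_Decomposition"
begin

definition linear_on_matrices :: "nat \<Rightarrow> (complex mat \<Rightarrow> complex mat) \<Rightarrow> bool" where
  "linear_on_matrices d \<Phi> \<longleftrightarrow>
     (\<forall>A \<in> carrier_mat d d. \<Phi> A \<in> carrier_mat d d) \<and>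
     (\<forall>A \<in> carrier_mat d d. \<forall>B \<in> carrier_mat d d. \<Phi> (A + B) = \<Phi> A + \<Phi> B) \<and>
     (\<forall>c. \<forall>A \<in> carrier_mat d d. \<Phi> (c \<cdot>\<^sub>m A) = c \<cdot>\<^sub>m \<Phi> A)"

(* The order on complex numbers is that of HOL-Library.Complex_Order:
   0 \<le> z means that z is real and nonnegative. *)
definition psd :: "nat \<Rightarrow> complex mat \<Rightarrow> bool" where
  "psd d A \<longleftrightarrow> A \<in> carrier_mat d d \<and> mat_adjoint A = A \<and>
     (\<forall>v \<in> carrier_vec d. 0 \<le> (A *\<^sub>v v) \<bullet>c v)"

definition positive_map :: "nat \<Rightarrow> (complex mat \<Rightarrow> complex mat) \<Rightarrow> bool" where
  "positive_map d \<Phi> \<longleftrightarrow> linear_on_matrices d \<Phi> \<and> (\<forall>A. psd d A \<longrightarrow> psd d (\<Phi> A))"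

(* The (a,b) block of size d x d of a matrix of size nd x nd. *)
definition block :: "nat \<Rightarrow> complex mat \<Rightarrow> nat \<Rightarrow> nat \<Rightarrow> complex mat" where
  "block d X a b = mat d d (\<lambda>(i, j). X $$ (a * d + i, b * d + j))"

(* id_n tensor \<Phi>, with the tensor product of the n x n and the d x d matrices identified with
   the nd x nd matrices through the Kronecker product: \<Phi> acts on each d x d block. *)
definition amplification :: "nat \<Rightarrow> nat \<Rightarrow> (complex mat \<Rightarrow> complex mat) \<Rightarrow> complex mat \<Rightarrow> complex mat" where
  "amplification n d \<Phi> X = mat (n * d) (n * d)
     (\<lambda>(r, c). \<Phi> (block d X (r div d) (c div d)) $$ (r mod d, c mod d))"

definition completely_positive :: "nat \<Rightarrow> (complex mat \<Rightarrow> complex mat) \<Rightarrow> bool" where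
  "completely_positive d \<Phi> \<longleftrightarrow> linear_on_matrices d \<Phi> \<and>
     (\<forall>n. positive_map (n * d) (amplification n d \<Phi>))"

definition kronecker :: "nat \<Rightarrow> nat \<Rightarrow> complex mat \<Rightarrow> complex mat \<Rightarrow> complex mat" where
  "kronecker n d E A = mat (n * d) (n * d)
     (\<lambda>(r, c). E $$ (r div d, c div d) * A $$ (r mod d, c mod d))"

(* This is the defining property of id_n tensor \<Phi>. *)
lemma amplification_kronecker:
  assumes "linear_on_matrices d \<Phi>" and "A \<in> carrier_mat d d"
  shows "amplification n d \<Phi> (kronecker n d E A) = kronecker n d E (\<Phi> A)"
proof (rule eq_matI)
  fix r c
  assume "r < dim_row (kronecker n d E (\<Phi> A))" "c < dim_col (kronecker n d E (\<Phi> A))"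
  then have r: "r < n * d" and c: "c < n * d" by (auto simp: kronecker_def)
  then have d: "d > 0" by (cases d) auto
  have rd: "r div d < n" "c div d < n" "r mod d < d" "c mod d < d"
    using r c d by (auto simp: less_mult_imp_div_less)
  have lt: "a * d + i < n * d" if "a < n" "i < d" for a i
  proof -
    have "a * d + i < Suc a * d" using that by simp
    also have "\<dots> \<le> n * d" using that by (intro mult_le_mono1) simp
    finally show ?thesis .
  qed
  have "block d (kronecker n d E A) (r div d) (c div d) = E $$ (r div d, c div d) \<cdot>\<^sub>m A"
    using assms(2) rd lt by (intro eq_matI) (auto simp: block_def kronecker_def)
  moreover have "\<Phi> (E $$ (r div d, c div d) \<cdot>\<^sub>m A) = E $$ (r div d, c div d) \<cdot>\<^sub>m \<Phi> A"
    and "\<Phi> A \<in> carrier_mat d d"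
    using assms by (auto simp: linear_on_matrices_def)
  ultimately show "amplification n d \<Phi> (kronecker n d E A) $$ (r, c) = kronecker n d E (\<Phi> A) $$ (r, c)"
    using r c rd by (simp add: amplification_def kronecker_def)
qed (auto simp: amplification_def kronecker_def)

(* Basis vectors are numbered from 1, whereas the indices of vec and mat start from 0. *)
definition ket :: "nat \<Rightarrow> complex vec" where
  "ket j = unit_vec 3 (j - 1)"

definition ketbra :: "nat \<Rightarrow> nat \<Rightarrow> complex mat" where
  "ketbra j k = mat 3 3 (\<lambda>(r, c). ket j $ r * conjugate (ket k $ c))"

(* The matrix element <j|\<rho>|k>; the product \<bullet>c is conjugate-linear in its second argument. *)
definition entry :: "complex mat \<Rightarrow> nat \<Rightarrow> nat \<Rightarrow> complex" where
  "entry \<rho> j k = (\<rho> *\<^sub>v ket k) \<bullet>c ket j"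

lemma entry_eq:
  assumes "\<rho> \<in> carrier_mat 3 3" "j \<in> {1..3}" "k \<in> {1..3}"
  shows "entry \<rho> j k = \<rho> $$ (j - 1, k - 1)"
proof -
  have "conjugate (ket j) = ket j"
    by (intro eq_vecI) (auto simp: ket_def unit_vec_def)
  moreover have "\<rho> *\<^sub>v ket k = col \<rho> (k - 1)"
    using assms by (intro eq_vecI) (auto simp: ket_def)
  ultimately show ?thesis
    using assms by (auto simp: entry_def ket_def)
qed

definition anticomm :: "complex mat \<Rightarrow> complex mat \<Rightarrow> complex mat" where
  "anticomm X Y = X * Y + Y * X"

(* The anticommutator is taken with L L^* (L^* the adjoint of L), not with L^* L. *)
definition dissipator :: "complex mat \<Rightarrow> complex mat \<Rightarrow> complex mat" where
  "dissipator L \<rho> = L * \<rho> * mat_adjoint L - (1/2) \<cdot>\<^sub>m anticomm (L * mat_adjoint L) \<rho>"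

definition A1 :: "complex mat" where "A1 = ketbra 1 2"
definition A2 :: "complex mat" where "A2 = ketbra 2 3"
definition A3 :: "complex mat" where "A3 = ketbra 3 1"

definition B :: "nat \<Rightarrow> complex mat" where "B j = ketbra j j"

definition C1 :: "complex mat" where "C1 = ketbra 1 1 - ketbra 2 2"
definition C2 :: "complex mat" where "C2 = ketbra 2 2 - ketbra 3 3"
definition C3 :: "complex mat" where "C3 = ketbra 3 3 - ketbra 1 1"

definition S1 :: "complex mat \<Rightarrow> complex mat" where
  "S1 \<rho> = dissipator A1 \<rho> + dissipator A2 \<rho> + dissipator A3 \<rho>"

definition S2 :: "complex mat \<Rightarrow> complex mat" where
  "S2 \<rho> = dissipator (B 1) \<rho> + dissipator (B 2) \<rho> + dissipator (B 3) \<rho>"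

definition S3 :: "complex mat \<Rightarrow> complex mat" where
  "S3 \<rho> = dissipator C1 \<rho> + dissipator C2 \<rho> + dissipator C3 \<rho>"

definition PhiC :: "real \<Rightarrow> complex mat \<Rightarrow> complex mat" where
  "PhiC \<beta> \<rho> = S1 \<rho> - complex_of_real \<beta> \<cdot>\<^sub>m (S2 \<rho> - S3 \<rho>)"

definition PhiCF :: "real \<Rightarrow> complex mat \<Rightarrow> complex mat" where
  "PhiCF \<beta> \<rho> = \<rho> + (1/2) \<cdot>\<^sub>m PhiC \<beta> \<rho>"

end

(* Entrywise, 2 PhiCF \<beta> \<rho> has diagonal entries \<rho>_ii + \<rho>_(i+1,i+1) and off-diagonal entries
   (1 - 2\<beta>) \<rho>_ij. The Schur multiplier 3/2 I - 1/2 J (J the all-ones matrix) is realised by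
   1/2 \<Sum> C_k \<rho> C_k^*, and \<beta> = 3/4 needs exactly this multiplier, so interpolating between
   \<beta> = 0 and \<beta> = 3/4 gives Kraus operators with nonnegative weights for \<beta> \<le> 3/4.

   PhiCF \<beta> interpolates linearly between PhiCF 0 and PhiCF 1, so positivity for \<beta> \<le> 1
   reduces to the Choi map. For a positive semidefinite \<rho> with x_i = sqrt \<rho>_ii, the 2 x 2 minors
   give |\<rho>_ij| \<le> x_i x_j. Hence the quadratic form of the Choi map at v, with y_i = |v_i|, is bounded
   below by a multiple of \<Sum> w_i y_i^2 - (\<Sum> x_i y_i)^2, where w_i = 2 x_i^2 + x_(i+1)^2. By
   Cauchy-Schwarz with weights w_i this is nonnegative once \<Sum> x_i^2 / w_i \<le> 1, which is the
   inequality between the arithmetic and the geometric mean after clearing denominators. *)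

theory Submission
  imports Defs
begin

section \<open>Positive semidefinite matrices in coordinates\<close>

lemma mat_adjoint_index:
  assumes "A \<in> carrier_mat n m" "i < m" "j < n"
  shows "mat_adjoint A $$ (i, j) = conjugate (A $$ (j, i))"
  using assms by (simp add: mat_adjoint_def mat_of_rows_index)

lemma mat_adjoint_carrier [simp]:
  "A \<in> carrier_mat n m \<Longrightarrow> mat_adjoint A \<in> carrier_mat m n"
  by (auto simp: mat_adjoint_def)

lemma quadratic_form_eq_sum:
  fixes A :: "complex mat"
  assumes "A \<in> carrier_mat d d" "v \<in> carrier_vec d"
  shows "(A *\<^sub>v v) \<bullet>c v = (\<Sum>r<d. \<Sum>c<d. A $$ (r, c) * v $ c * cnj (v $ r))"
  using assms by (auto simp: scalar_prod_def sum_distrib_right lessThan_atLeast0 intro!: sum.cong)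

text \<open>Test vectors become arbitrary functions \<open>f\<close>, of which only the values below
  \<open>d\<close> matter, so that later arguments are manipulations of finite sums without carrier
  conditions on vectors.\<close>

lemma psd_iff_sum:
  "psd d A \<longleftrightarrow> A \<in> carrier_mat d d \<and> (\<forall>i<d. \<forall>j<d. cnj (A $$ (j, i)) = A $$ (i, j)) \<and>
     (\<forall>f. 0 \<le> (\<Sum>r<d. \<Sum>c<d. A $$ (r, c) * f c * cnj (f r)))"
proof (cases "A \<in> carrier_mat d d")
  case A: True
  have "mat_adjoint A = A \<longleftrightarrow> (\<forall>i<d. \<forall>j<d. cnj (A $$ (j, i)) = A $$ (i, j))" (is "?L = ?R")
  proof
    show "?R" if "?L" using mat_adjoint_index[OF A] that by (metis conjugate_complex_def)
    show "?L" if "?R"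
      using A carrier_matD[OF mat_adjoint_carrier[OF A]] mat_adjoint_index[OF A] that
      by (intro eq_matI) auto
  qed
  moreover have "(\<forall>v \<in> carrier_vec d. 0 \<le> (A *\<^sub>v v) \<bullet>c v) \<longleftrightarrow>
      (\<forall>f. 0 \<le> (\<Sum>r<d. \<Sum>c<d. A $$ (r, c) * f c * cnj (f r)))" (is "?L = ?R")
  proof
    show "?R" if L: "?L"
    proof
      fix f
      have "0 \<le> (A *\<^sub>v vec d f) \<bullet>c vec d f" using L by simp
      then show "0 \<le> (\<Sum>r<d. \<Sum>c<d. A $$ (r, c) * f c * cnj (f r))"
        by (simp add: quadratic_form_eq_sum[OF A])
    qed
    show "?L" if "?R" using that by (simp add: quadratic_form_eq_sum[OF A])
  qed
  ultimately show ?thesis using A by (simp add: psd_def)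
qed (simp add: psd_def)

lemma psd_add:
  assumes "psd d A" "psd d X"
  shows "psd d (A + X)"
proof -
  have A: "A \<in> carrier_mat d d" and X: "X \<in> carrier_mat d d" using assms by (auto simp: psd_def)
  have "(\<Sum>r<d. \<Sum>c<d. (A + X) $$ (r, c) * f c * cnj (f r)) =
      (\<Sum>r<d. \<Sum>c<d. A $$ (r, c) * f c * cnj (f r)) + (\<Sum>r<d. \<Sum>c<d. X $$ (r, c) * f c * cnj (f r))" for f
    using A X by (simp add: distrib_right sum.distrib cong: sum.cong_simp)
  then show ?thesis using assms by (auto simp: psd_iff_sum)
qed

lemma psd_smult:
  assumes "psd d A" "0 \<le> t"
  shows "psd d (complex_of_real t \<cdot>\<^sub>m A)"
proof -
  have A: "A \<in> carrier_mat d d" using assms by (simp add: psd_def)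
  have "(\<Sum>r<d. \<Sum>c<d. (complex_of_real t \<cdot>\<^sub>m A) $$ (r, c) * f c * cnj (f r)) =
      complex_of_real t * (\<Sum>r<d. \<Sum>c<d. A $$ (r, c) * f c * cnj (f r))" for f
    using A by (simp add: sum_distrib_left mult.assoc cong: sum.cong_simp)
  moreover have "0 \<le> complex_of_real t" using assms by (simp add: less_eq_complex_def)
  ultimately show ?thesis using assms
    by (auto simp: psd_iff_sum intro!: mult_nonneg_nonneg)
qed

text \<open>The entries of \<open>Y\<close> are those of K X K^*, with the matrix K given as a
  function. Hence the quadratic form of \<open>Y\<close> at \<open>f\<close> is the form of
  \<open>X\<close> at K^* f, which is \<open>g\<close> in the proof; the rest is interchanging
  sums.\<close>

lemma psd_congruence:
  assumes X: "psd m X" and Y: "Y \<in> carrier_mat n n"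
    and eq: "\<And>r c. r < n \<Longrightarrow> c < n \<Longrightarrow>
      Y $$ (r, c) = (\<Sum>k<m. \<Sum>l<m. K r k * X $$ (k, l) * cnj (K c l))"
  shows "psd n Y"
  unfolding psd_iff_sum
proof (intro conjI allI impI)
  show "cnj (Y $$ (j, i)) = Y $$ (i, j)" if "i < n" "j < n" for i j
  proof -
    have "cnj (Y $$ (j, i)) = (\<Sum>k<m. \<Sum>l<m. cnj (K j k) * cnj (X $$ (k, l)) * K i l)"
      using that by (simp add: eq)
    also have "\<dots> = (\<Sum>k<m. \<Sum>l<m. cnj (K j k) * X $$ (l, k) * K i l)"
      using X by (intro sum.cong refl) (auto simp: psd_iff_sum)
    also have "\<dots> = Y $$ (i, j)"
      using that by (subst sum.swap) (simp add: eq mult_ac)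
    finally show ?thesis by simp
  qed
  fix f
  define g where "g = (\<lambda>k. \<Sum>c<n. cnj (K c k) * f c)"
  have "(\<Sum>r<n. \<Sum>c<n. Y $$ (r, c) * f c * cnj (f r)) =
      (\<Sum>r<n. \<Sum>c<n. \<Sum>k<m. \<Sum>l<m. X $$ (k, l) * (cnj (K c l) * f c) * cnj (cnj (K r k) * f r))"
    by (simp add: eq sum_distrib_left sum_distrib_right mult_ac)
  also have "\<dots> = (\<Sum>r<n. \<Sum>k<m. \<Sum>c<n. \<Sum>l<m. X $$ (k, l) * (cnj (K c l) * f c) * cnj (cnj (K r k) * f r))"
    by (intro sum.cong refl sum.swap)
  also have "\<dots> = (\<Sum>k<m. \<Sum>r<n. \<Sum>l<m. \<Sum>c<n. X $$ (k, l) * (cnj (K c l) * f c) * cnj (cnj (K r k) * f r))"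
    by (subst sum.swap) (intro sum.cong refl sum.swap)
  also have "\<dots> = (\<Sum>k<m. \<Sum>l<m. \<Sum>r<n. \<Sum>c<n. X $$ (k, l) * (cnj (K c l) * f c) * cnj (cnj (K r k) * f r))"
    by (intro sum.cong refl sum.swap)
  also have "\<dots> = (\<Sum>k<m. \<Sum>l<m. X $$ (k, l) * g l * cnj (g k))"
    by (simp add: g_def sum_distrib_left sum_distrib_right)
  finally show "0 \<le> (\<Sum>r<n. \<Sum>c<n. Y $$ (r, c) * f c * cnj (f r))"
    using X by (simp add: psd_iff_sum)
qed (use Y in auto)

text \<open>Restricting the quadratic form to vectors supported on \<open>{i, j}\<close> gives a
  nonnegative form in two variables. After the phase of the off-diagonal entry is removed, it is a
  real form whose discriminant yields the bound.\<close>

lemma psd_minor: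
  assumes A: "psd d A" and ij: "i < d" "j < d" "i \<noteq> j"
  shows "cmod (A $$ (i, j)) \<le> sqrt (Re (A $$ (i, i))) * sqrt (Re (A $$ (j, j)))"
    and "0 \<le> A $$ (i, i)"
proof -
  have form: "0 \<le> A $$ (i, i) * a * cnj a + A $$ (i, j) * b * cnj a
      + A $$ (j, i) * a * cnj b + A $$ (j, j) * b * cnj b" for a b
  proof -
    let ?f = "\<lambda>k. if k = i then a else if k = j then b else 0"
    have "(\<Sum>r<d. \<Sum>c<d. A $$ (r, c) * ?f c * cnj (?f r)) =
        (\<Sum>r\<in>{i,j}. \<Sum>c\<in>{i,j}. A $$ (r, c) * ?f c * cnj (?f r))"
    proof -
      have "(\<Sum>c<d. A $$ (r, c) * ?f c * cnj (?f r)) = (\<Sum>c\<in>{i,j}. A $$ (r, c) * ?f c * cnj (?f r))" for r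
        using ij by (intro sum.mono_neutral_right) auto
      then have "(\<Sum>r<d. \<Sum>c<d. A $$ (r, c) * ?f c * cnj (?f r)) =
          (\<Sum>r<d. \<Sum>c\<in>{i,j}. A $$ (r, c) * ?f c * cnj (?f r))" by simp
      also have "\<dots> = (\<Sum>r\<in>{i,j}. \<Sum>c\<in>{i,j}. A $$ (r, c) * ?f c * cnj (?f r))"
        using ij by (intro sum.mono_neutral_right) auto
      finally show ?thesis .
    qed
    moreover have "0 \<le> (\<Sum>r<d. \<Sum>c<d. A $$ (r, c) * ?f c * cnj (?f r))"
      using A by (simp only: psd_iff_sum)
    ultimately show ?thesis using ij(3) by (simp add: algebra_simps)
  qed
  show pi: "0 \<le> A $$ (i, i)" using form[of 1 0] by simp
  have pj: "0 \<le> A $$ (j, j)" using form[of 0 1] by simp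
  define z where "z = A $$ (i, j)"
  define p q where "p = Re (A $$ (i, i))" and "q = Re (A $$ (j, j))"
  have p: "A $$ (i, i) = of_real p" "0 \<le> p" and q: "A $$ (j, j) = of_real q" "0 \<le> q"
    using pi pj by (auto simp: p_def q_def less_eq_complex_def complex_eq_iff)
  have z: "A $$ (j, i) = cnj z" using A ij by (auto simp: psd_iff_sum z_def)
  show "cmod (A $$ (i, j)) \<le> sqrt (Re (A $$ (i, i))) * sqrt (Re (A $$ (j, j)))"
  proof (cases "z = 0")
    case False
    have real_form: "2 * s * t * cmod z \<le> s\<^sup>2 * p + t\<^sup>2 * q" for s t
    proof -
      \<comment> \<open>\<open>u\<close> is the phase of \<open>z\<close>: at coordinates
        \<open>s * u\<close> and \<open>-t\<close> the two cross terms become real and add up to -2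
        s t |z|.\<close>
      define u where "u = sgn z"
      have u: "z * cnj u = of_real (cmod z)" "cnj z * u = of_real (cmod z)" "u * cnj u = 1"
        using False unfolding u_def sgn_div_norm 
        by (auto simp: complex_eq_iff field_simps cmod_def power2_eq_square)
      have "0 \<le> of_real p * (of_real s * u) * cnj (of_real s * u) + z * (- of_real t) * cnj (of_real s * u)
        + cnj z * (of_real s * u) * cnj (- of_real t) + of_real q * (- of_real t) * cnj (- of_real t)"
        using form[of "of_real s * u" "- of_real t"] by (simp only: p q z z_def[symmetric])
      also have "\<dots> = of_real p * of_real s * of_real s * (u * cnj u) - of_real s * of_real t * (z * cnj u)
        - of_real s * of_real t * (cnj z * u) + of_real q * of_real t * of_real t"
        by (simp add: algebra_simps)
      also have "\<dots> = of_real (s\<^sup>2 * p + t\<^sup>2 * q - 2 * s * t * cmod z)"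
        unfolding u by (simp add: power2_eq_square algebra_simps)
      finally show ?thesis by (simp add: less_eq_complex_def)
    qed
    have "(cmod z)\<^sup>2 \<le> p * q"
    proof (cases "p = 0")
      case True
      \<comment> \<open>If \<open>p = 0\<close>, the form is affine in \<open>s\<close>; this choice
        of \<open>s\<close> forces 2 (q + 1) \<le> q, which contradicts
        \<open>0 \<le> q\<close>.\<close>
      have "2 * (q + 1) = 2 * ((q + 1) / cmod z) * 1 * cmod z" using False by simp
      also have "\<dots> \<le> q" using real_form[of "(q + 1) / cmod z" 1] True by simp
      finally show ?thesis using q by simp
    next
      case pn: False
      \<comment> \<open>\<open>cmod z / p\<close> minimises s^2 p - 2 s |z| + q over s.\<close>
      then show ?thesis using real_form[of "cmod z / p" 1] p
        by (simp add: field_simps power2_eq_square)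
    qed
    then have "cmod z \<le> sqrt (p * q)" by (simp add: real_le_rsqrt)
    then show ?thesis by (simp add: real_sqrt_mult z_def p_def q_def)
  qed (use p q in \<open>simp add: z_def\<close>)
qed

section \<open>The scalar inequality behind positivity of the Choi map\<close>

lemma cyclic_AM_GM:
  fixes a b c :: real
  assumes "0 < a" "0 < b" "0 < c"
  shows "3 * a * b * c \<le> a\<^sup>2 * c + b\<^sup>2 * a + c\<^sup>2 * b"
proof -
  \<comment> \<open>The three summands on the right have product (x y z)^3. With the smallest
    variable first and \<open>p\<close>, \<open>q\<close> the gaps to the other two, the difference
    of the sides is x (p^2 - p q + q^2) + q^2 p.\<close>
  have *: "3 * x * y * z \<le> x\<^sup>2 * z + y\<^sup>2 * x + z\<^sup>2 * y" if "0 < x" "x \<le> y" "x \<le> z" for x y z :: real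
  proof -
    define p q where "p = y - x" and "q = z - x"
    have "0 \<le> ((p - q)\<^sup>2 + p\<^sup>2 + q\<^sup>2) / 2 * x + q\<^sup>2 * p"
      using that by (simp add: p_def q_def)
    also have "\<dots> = x\<^sup>2 * z + y\<^sup>2 * x + z\<^sup>2 * y - 3 * x * y * z"
      by (simp add: p_def q_def field_simps power2_eq_square)
    finally show ?thesis by simp
  qed
  \<comment> \<open>The inequality is invariant under cyclic shifts only, which suffices to move the
    smallest variable to the front.\<close>
  consider "a \<le> b" "a \<le> c" | "b \<le> a" "b \<le> c" | "c \<le> a" "c \<le> b" by linarith
  then show ?thesis
    using *[of a b c] *[of b c a] *[of c a b] assms by cases (simp_all add: mult_ac)
qed

text \<open>Over the common denominator, the gap between the two sides has numerator a^2 c + b^2 a +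
  c^2 b - 3 a b c.\<close>

lemma choi_weights:
  fixes a b c :: real
  assumes "0 < a" "0 < b" "0 < c"
  shows "a / (2 * a + b) + b / (2 * b + c) + c / (2 * c + a) \<le> 1"
proof -
  have pos: "0 < 2 * a + b" "0 < 2 * b + c" "0 < 2 * c + a" using assms by auto
  have "a * (2 * b + c) * (2 * c + a) + b * (2 * a + b) * (2 * c + a) + c * (2 * a + b) * (2 * b + c)
      \<le> (2 * a + b) * (2 * b + c) * (2 * c + a)"
    using cyclic_AM_GM[OF assms] by (simp add: algebra_simps power2_eq_square)
  moreover have "a / (2 * a + b) + b / (2 * b + c) + c / (2 * c + a) =
      (a * (2 * b + c) * (2 * c + a) + b * (2 * a + b) * (2 * c + a) + c * (2 * a + b) * (2 * b + c))
      / ((2 * a + b) * (2 * b + c) * (2 * c + a))"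
    using pos by (simp add: add_divide_distrib)
  ultimately show ?thesis using pos by (simp add: pos_divide_le_eq)
qed

text \<open>Cancelling the terms x_i^2 y_i^2 leaves the weights x_i^2 + x_(i+1)^2 against the cross
  terms 2 x_i x_j y_i y_j, which is the estimate needed for twice the quadratic form of
  \<open>PhiCF 1\<close>.\<close>

lemma choi_form_ge_square:
  fixes x1 x2 x3 y1 y2 y3 :: real
  shows "(x1 * y1 + x2 * y2 + x3 * y3)\<^sup>2
    \<le> (2 * x1\<^sup>2 + x2\<^sup>2) * y1\<^sup>2 + (2 * x2\<^sup>2 + x3\<^sup>2) * y2\<^sup>2 + (2 * x3\<^sup>2 + x1\<^sup>2) * y3\<^sup>2"
    (is "?s\<^sup>2 \<le> ?R x1 x2 x3 y1 y2 y3")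
proof -
  \<comment> \<open>\<open>choi_weights\<close> needs positive arguments, so a vanishing x_i is
    treated apart. Here \<open>u\<close>, \<open>v\<close> are the other two in cyclic order, and
    the gap is an explicit sum of squares.\<close>
  have zero: "(u * y + v * z)\<^sup>2 \<le> u\<^sup>2 * x\<^sup>2 + (2 * u\<^sup>2 + v\<^sup>2) * y\<^sup>2 + 2 * v\<^sup>2 * z\<^sup>2" for u v x y z :: real
  proof -
    have "0 \<le> (u * y - v * z)\<^sup>2 + u\<^sup>2 * x\<^sup>2 + v\<^sup>2 * y\<^sup>2" by simp
    then show ?thesis by (simp add: algebra_simps power2_eq_square)
  qed
  show ?thesis
  proof (cases "x1 = 0 \<or> x2 = 0 \<or> x3 = 0")
    case True
    then show ?thesis
      using zero[of x2 y2 x3 y3 y1] zero[of x3 y3 x1 y1 y2] zero[of x1 y1 x2 y2 y3]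
      by (auto simp: algebra_simps)
  next
    case False
    then have pos: "0 < x1\<^sup>2" "0 < x2\<^sup>2" "0 < x3\<^sup>2" by auto
    define s where "s = ?s"
    \<comment> \<open>This is Cauchy-Schwarz in linearised form: summing the three instances, with
      \<open>s\<close> the whole sum, bounds 2 s^2 by the right-hand side plus s^2.\<close>
    have amgm: "2 * s * x * y \<le> w * y\<^sup>2 + s\<^sup>2 * (x\<^sup>2 / w)" if "0 < w" for x y w
    proof -
      have "0 \<le> (w * y - s * x)\<^sup>2 / w" using that by simp
      also have "\<dots> = w * y\<^sup>2 + s\<^sup>2 * (x\<^sup>2 / w) - 2 * s * x * y"
        using that by (simp add: field_simps power2_eq_square)
      finally show ?thesis by simp
    qed
    have "2 * s * x1 * y1 + 2 * s * x2 * y2 + 2 * s * x3 * y3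
      \<le> ?R x1 x2 x3 y1 y2 y3 + s\<^sup>2 * (x1\<^sup>2 / (2 * x1\<^sup>2 + x2\<^sup>2) + x2\<^sup>2 / (2 * x2\<^sup>2 + x3\<^sup>2) + x3\<^sup>2 / (2 * x3\<^sup>2 + x1\<^sup>2))"
      using amgm[of "2 * x1\<^sup>2 + x2\<^sup>2" x1 y1] amgm[of "2 * x2\<^sup>2 + x3\<^sup>2" x2 y2]
        amgm[of "2 * x3\<^sup>2 + x1\<^sup>2" x3 y3] pos by (simp add: distrib_left)
    also have "\<dots> \<le> ?R x1 x2 x3 y1 y2 y3 + s\<^sup>2 * 1"
      using choi_weights[OF pos] by (intro add_left_mono mult_left_mono) auto
    also have "2 * s * x1 * y1 + 2 * s * x2 * y2 + 2 * s * x3 * y3 = 2 * s\<^sup>2"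
      by (simp add: s_def algebra_simps power2_eq_square)
    finally show ?thesis by (simp add: s_def)
  qed
qed

section \<open>Amplifications, linear maps and complete positivity\<close>

lemma sum_block:
  fixes g :: "nat \<Rightarrow> 'a::comm_monoid_add"
  assumes "a < n" "0 < d"
  shows "(\<Sum>k<n * d. if k div d = a then g k else 0) = (\<Sum>k<d. g (a * d + k))"
proof -
  have "(\<Sum>k<n * d. if k div d = a then g k else 0) = (\<Sum>k\<in>{k. k < n * d \<and> k div d = a}. g k)"
    by (simp add: sum.If_cases Int_def)
  also have "\<dots> = (\<Sum>k<d. g (a * d + k))"
  proof (rule sum.reindex_bij_witness[of _ "\<lambda>k. a * d + k" "\<lambda>k. k mod d"])
    fix k assume "k \<in> {..<d}"
    then have "a * d + k < Suc a * d" by simp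
    also have "\<dots> \<le> n * d" using assms by (intro mult_le_mono1) simp
    finally show "a * d + k \<in> {k. k < n * d \<and> k div d = a}"
      using \<open>k \<in> {..<d}\<close> by simp
  qed (use assms in auto)
  finally show ?thesis .
qed

lemma block_carrier [simp]: "block d X a b \<in> carrier_mat d d"
  by (simp add: block_def)

lemma linear_on_amplification:
  assumes "linear_on_matrices d \<Phi>"
  shows "linear_on_matrices (n * d) (amplification n d \<Phi>)"
proof (cases "d = 0")
  case False
  then have idx: "r div d < n" "r mod d < d" if "r < n * d" for r
    using that by (auto simp: less_mult_imp_div_less)
  have lt: "a * d + i < n * d" if "a < n" "i < d" for a i
  proof -
    have "a * d + i < Suc a * d" using that by simp
    also have "\<dots> \<le> n * d" using that by (intro mult_le_mono1) simp
    finally show ?thesis .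
  qed
  have car: "\<Phi> X \<in> carrier_mat d d" if "X \<in> carrier_mat d d" for X
    using assms that by (simp add: linear_on_matrices_def)
  have "block d (X + Y) a b = block d X a b + block d Y a b"
    if "X \<in> carrier_mat (n * d) (n * d)" "Y \<in> carrier_mat (n * d) (n * d)" "a < n" "b < n" for X Y a b
    using that lt by (intro eq_matI) (auto simp: block_def)
  moreover have "block d (c \<cdot>\<^sub>m X) a b = c \<cdot>\<^sub>m block d X a b"
    if "X \<in> carrier_mat (n * d) (n * d)" "a < n" "b < n" for c X a b
    using that lt by (intro eq_matI) (auto simp: block_def)
  moreover have "\<Phi> (block d X a b + block d Y a' b') = \<Phi> (block d X a b) + \<Phi> (block d Y a' b')"
    "\<Phi> (c \<cdot>\<^sub>m block d X a b) = c \<cdot>\<^sub>m \<Phi> (block d X a b)" for X Y a b a' b' c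
    using assms by (auto simp: linear_on_matrices_def)
  ultimately show ?thesis
    using idx carrier_matD[OF car[OF block_carrier]] unfolding linear_on_matrices_def
    by (auto simp: amplification_def intro!: eq_matI)
qed (auto simp: linear_on_matrices_def amplification_def intro!: eq_matI)

lemma linear_on_matricesD:
  assumes "linear_on_matrices d \<Phi>" "X \<in> carrier_mat d d"
  shows "\<Phi> X \<in> carrier_mat d d" "\<Phi> (c \<cdot>\<^sub>m X) = c \<cdot>\<^sub>m \<Phi> X"
    and "Y \<in> carrier_mat d d \<Longrightarrow> \<Phi> (X + Y) = \<Phi> X + \<Phi> Y"
  using assms by (auto simp: linear_on_matrices_def)

lemma linear_on_matrices_add:
  assumes "linear_on_matrices d \<Phi>" "linear_on_matrices d \<Psi>"
  shows "linear_on_matrices d (\<lambda>\<rho>. \<Phi> \<rho> + \<Psi> \<rho>)"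
  unfolding linear_on_matrices_def
proof (intro conjI ballI allI)
  fix X Y :: "complex mat" and c :: complex
  assume X: "X \<in> carrier_mat d d"
  note lX = assms[THEN linear_on_matricesD(1), OF X]
  show "\<Phi> X + \<Psi> X \<in> carrier_mat d d" using lX by simp
  show "\<Phi> (c \<cdot>\<^sub>m X) + \<Psi> (c \<cdot>\<^sub>m X) = c \<cdot>\<^sub>m (\<Phi> X + \<Psi> X)"
    unfolding assms[THEN linear_on_matricesD(2), OF X]
    using lX by (simp add: add_smult_distrib_left_mat[of _ d d])
  assume Y: "Y \<in> carrier_mat d d"
  show "\<Phi> (X + Y) + \<Psi> (X + Y) = \<Phi> X + \<Psi> X + (\<Phi> Y + \<Psi> Y)"
    unfolding assms[THEN linear_on_matricesD(3), OF X Y]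
    using lX assms[THEN linear_on_matricesD(1), OF Y] by (intro eq_matI) auto
qed

lemma linear_on_matrices_smult:
  assumes "linear_on_matrices d \<Phi>"
  shows "linear_on_matrices d (\<lambda>\<rho>. t \<cdot>\<^sub>m \<Phi> \<rho>)"
  unfolding linear_on_matrices_def
proof (intro conjI ballI allI)
  fix X Y :: "complex mat" and c :: complex
  assume X: "X \<in> carrier_mat d d"
  note lX = linear_on_matricesD(1)[OF assms X]
  show "t \<cdot>\<^sub>m \<Phi> X \<in> carrier_mat d d" using lX by simp
  show "t \<cdot>\<^sub>m \<Phi> (c \<cdot>\<^sub>m X) = c \<cdot>\<^sub>m (t \<cdot>\<^sub>m \<Phi> X)"
    unfolding linear_on_matricesD(2)[OF assms X] using lX by (intro eq_matI) auto
  assume Y: "Y \<in> carrier_mat d d"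
  show "t \<cdot>\<^sub>m \<Phi> (X + Y) = t \<cdot>\<^sub>m \<Phi> X + t \<cdot>\<^sub>m \<Phi> Y"
    unfolding linear_on_matricesD(3)[OF assms X Y]
    using lX linear_on_matricesD(1)[OF assms Y] by (simp add: add_smult_distrib_left_mat[of _ d d])
qed

lemma linear_on_matrices_cong:
  assumes "linear_on_matrices d \<Phi>" "\<And>\<rho>. \<rho> \<in> carrier_mat d d \<Longrightarrow> \<Psi> \<rho> = \<Phi> \<rho>"
  shows "linear_on_matrices d \<Psi>"
  using assms by (auto simp: linear_on_matrices_def)

text \<open>An amplification evaluates the map on blocks only, and these are always \<open>d\<close>
  x \<open>d\<close> matrices.\<close>

lemma completely_positive_cong:
  assumes "completely_positive d \<Phi>" "\<And>\<rho>. \<rho> \<in> carrier_mat d d \<Longrightarrow> \<Psi> \<rho> = \<Phi> \<rho>"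
  shows "completely_positive d \<Psi>"
proof -
  have "amplification n d \<Psi> = amplification n d \<Phi>" for n
    using assms(2) by (auto simp: amplification_def)
  then show ?thesis
    using assms linear_on_matrices_cong[of d \<Phi> \<Psi>] by (auto simp: completely_positive_def)
qed

lemma completely_positive_add:
  assumes "completely_positive d \<Phi>" "completely_positive d \<Psi>"
  shows "completely_positive d (\<lambda>\<rho>. \<Phi> \<rho> + \<Psi> \<rho>)"
proof -
  have lin: "linear_on_matrices d \<Phi>" "linear_on_matrices d \<Psi>"
    using assms by (auto simp: completely_positive_def)
  have "amplification n d (\<lambda>\<rho>. \<Phi> \<rho> + \<Psi> \<rho>) X = amplification n d \<Phi> X + amplification n d \<Psi> X" for n X
  proof (cases "d = 0")
    case False
    have "\<Psi> (block d X a b) \<in> carrier_mat d d" for a b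
      using lin by (simp add: linear_on_matrices_def)
    from carrier_matD[OF this] False show ?thesis
      by (intro eq_matI) (auto simp: amplification_def)
  qed (auto simp: amplification_def)
  then show ?thesis
    using assms linear_on_matrices_add[OF lin]
    by (auto simp: completely_positive_def positive_map_def intro!: linear_on_amplification psd_add)
qed

lemma completely_positive_smult:
  assumes "completely_positive d \<Phi>" "0 \<le> t"
  shows "completely_positive d (\<lambda>\<rho>. complex_of_real t \<cdot>\<^sub>m \<Phi> \<rho>)"
proof -
  have lin: "linear_on_matrices d \<Phi>"
    using assms by (auto simp: completely_positive_def)
  have "amplification n d (\<lambda>\<rho>. complex_of_real t \<cdot>\<^sub>m \<Phi> \<rho>) X = complex_of_real t \<cdot>\<^sub>m amplification n d \<Phi> X" for n X
  proof (cases "d = 0")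
    case False
    have "\<Phi> (block d X a b) \<in> carrier_mat d d" for a b
      using lin by (simp add: linear_on_matrices_def)
    from carrier_matD[OF this] False show ?thesis
      by (intro eq_matI) (auto simp: amplification_def)
  qed (auto simp: amplification_def)
  then show ?thesis
    using assms linear_on_matrices_smult[OF lin]
    by (auto simp: completely_positive_def positive_map_def intro!: linear_on_amplification psd_smult)
qed

lemma conjugation_index:
  fixes L :: "complex mat"
  assumes "L \<in> carrier_mat d d" "\<rho> \<in> carrier_mat d d" "i < d" "j < d"
  shows "(L * \<rho> * mat_adjoint L) $$ (i, j) = (\<Sum>k<d. \<Sum>l<d. L $$ (i, k) * \<rho> $$ (k, l) * cnj (L $$ (j, l)))"
proof -
  have "(L * \<rho> * mat_adjoint L) $$ (i, j) = (\<Sum>l<d. (\<Sum>k<d. L $$ (i, k) * \<rho> $$ (k, l)) * cnj (L $$ (j, l)))"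
    using assms carrier_matD[OF mat_adjoint_carrier[OF assms(1)]]
    by (simp add: scalar_prod_def lessThan_atLeast0 mat_adjoint_index[OF assms(1)] cong: sum.cong_simp)
  then show ?thesis by (subst sum.swap) (simp add: sum_distrib_right)
qed

lemma linear_on_conjugation:
  fixes L :: "complex mat"
  assumes L: "L \<in> carrier_mat d d"
  shows "linear_on_matrices d (\<lambda>\<rho>. L * \<rho> * mat_adjoint L)"
proof -
  note A = mat_adjoint_carrier[OF L]
  show ?thesis
    unfolding linear_on_matrices_def
  proof (intro conjI ballI allI)
    fix X Y :: "complex mat" and c :: complex
    assume X: "X \<in> carrier_mat d d"
    show "L * X * mat_adjoint L \<in> carrier_mat d d"
      by (rule mult_carrier_mat[OF mult_carrier_mat[OF L X] A])
    show "L * (c \<cdot>\<^sub>m X) * mat_adjoint L = c \<cdot>\<^sub>m (L * X * mat_adjoint L)"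
      using L X A by (simp add: mult_smult_distrib[of _ d d _ d] mult_smult_assoc_mat[of _ d d _ d])
    assume Y: "Y \<in> carrier_mat d d"
    show "L * (X + Y) * mat_adjoint L = L * X * mat_adjoint L + L * Y * mat_adjoint L"
      using L X Y A by (simp add: mult_add_distrib_mat[of _ d d _ d] add_mult_distrib_mat[of _ d d _ _ d])
  qed
qed

text \<open>The amplification of a conjugation is again a conjugation, by the identity tensored with
  \<open>L\<close>, so it is a congruence and \<open>psd_congruence\<close> applies.\<close>

lemma completely_positive_conjugation:
  fixes L :: "complex mat"
  assumes L: "L \<in> carrier_mat d d"
  shows "completely_positive d (\<lambda>\<rho>. L * \<rho> * mat_adjoint L)" (is "completely_positive d ?\<Phi>")
  unfolding completely_positive_def positive_map_def
proof (intro conjI allI impI)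
  show "linear_on_matrices d ?\<Phi>" by (rule linear_on_conjugation[OF L])
  then show "linear_on_matrices (n * d) (amplification n d ?\<Phi>)" for n
    by (rule linear_on_amplification)
  fix n X assume X: "psd (n * d) X"
  \<comment> \<open>the entries of the Kronecker product of the identity and \<open>L\<close>\<close>
  define K where "K = (\<lambda>r k. if k div d = r div d then L $$ (r mod d, k mod d) else 0)"
  show "psd (n * d) (amplification n d ?\<Phi> X)"
  proof (rule psd_congruence[OF X, where K = K])
    fix r c assume r: "r < n * d" and c: "c < n * d"
    then have d: "0 < d" by (cases d) auto
    then have idx: "r div d < n" "c div d < n" "r mod d < d" "c mod d < d"
      using r c by (auto simp: less_mult_imp_div_less)
    \<comment> \<open>\<open>K r k\<close> vanishes unless \<open>k\<close> lies in the block of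
      \<open>r\<close>, so both sums collapse to a single block by \<open>sum_block\<close>.\<close>
    have "(\<Sum>k<n * d. \<Sum>l<n * d. K r k * X $$ (k, l) * cnj (K c l)) =
        (\<Sum>k<n * d. if k div d = r div d then
           (\<Sum>l<n * d. if l div d = c div d
              then L $$ (r mod d, k mod d) * X $$ (k, l) * cnj (L $$ (c mod d, l mod d)) else 0) else 0)"
      by (intro sum.cong refl) (auto simp: K_def intro!: sum.cong)
    also have "\<dots> = (\<Sum>k<d. \<Sum>l<d. L $$ (r mod d, k) * X $$ (r div d * d + k, c div d * d + l) * cnj (L $$ (c mod d, l)))"
      using idx d by (simp add: sum_block cong: sum.cong_simp)
    also have "\<dots> = amplification n d ?\<Phi> X $$ (r, c)"
      using r c idx by (simp add: amplification_def conjugation_index[OF L block_carrier] cong: sum.cong_simp)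
        (simp add: block_def cong: sum.cong_simp)
    finally show "amplification n d ?\<Phi> X $$ (r, c) = (\<Sum>k<n * d. \<Sum>l<n * d. K r k * X $$ (k, l) * cnj (K c l))" ..
  qed (simp add: amplification_def)
qed

text \<open>For \<open>n = 1\<close> there is a single block, and the amplification agrees with the
  map itself.\<close>

lemma completely_positive_imp_positive_map:
  assumes "completely_positive d \<Phi>"
  shows "positive_map d \<Phi>"
proof -
  have lin: "linear_on_matrices d \<Phi>" and pos: "positive_map (1 * d) (amplification 1 d \<Phi>)"
    using assms unfolding completely_positive_def by blast+
  have "amplification 1 d \<Phi> X = \<Phi> X" if "X \<in> carrier_mat d d" for X
  proof -
    have "block d X 0 0 = X" using that by (intro eq_matI) (auto simp: block_def)
    moreover have "\<Phi> X \<in> carrier_mat d d" using lin that by (simp add: linear_on_matrices_def)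
    ultimately show ?thesis by (intro eq_matI) (auto simp: amplification_def)
  qed
  then show ?thesis using lin pos by (auto simp: positive_map_def psd_def)
qed

section \<open>Entries and Kraus form of the maps\<close>

lemma sum_lessThan_3: "(\<Sum>k<3. g k) = g 0 + g 1 + g (2::nat)"
  for g :: "nat \<Rightarrow> 'a::comm_monoid_add"
  by (simp add: eval_nat_numeral)

lemma ketbra_carrier [simp]: "ketbra j k \<in> carrier_mat 3 3"
  by (simp add: ketbra_def)

lemma ketbra_index:
  "\<lbrakk>r < 3; c < 3\<rbrakk> \<Longrightarrow> ketbra j k $$ (r, c) = (if r = j - 1 \<and> c = k - 1 then 1 else 0)"
  by (auto simp: ketbra_def ket_def unit_vec_def)

lemma jump_operator_carrier [simp]:
  "A1 \<in> carrier_mat 3 3" "A2 \<in> carrier_mat 3 3" "A3 \<in> carrier_mat 3 3" "B j \<in> carrier_mat 3 3"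
  "C1 \<in> carrier_mat 3 3" "C2 \<in> carrier_mat 3 3" "C3 \<in> carrier_mat 3 3"
  by (simp_all add: A1_def A2_def A3_def B_def C1_def C2_def C3_def minus_carrier_mat)

lemma jump_operator_index:
  assumes "r < 3" "c < 3"
  shows "A1 $$ (r, c) = (if r = 0 \<and> c = 1 then 1 else 0)"
    and "A2 $$ (r, c) = (if r = 1 \<and> c = 2 then 1 else 0)"
    and "A3 $$ (r, c) = (if r = 2 \<and> c = 0 then 1 else 0)"
    and "B j $$ (r, c) = (if r = j - 1 \<and> c = j - 1 then 1 else 0)"
    and "C1 $$ (r, c) = (if r = c then if r = 0 then 1 else if r = 1 then -1 else 0 else 0)"
    and "C2 $$ (r, c) = (if r = c then if r = 1 then 1 else if r = 2 then -1 else 0 else 0)"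
    and "C3 $$ (r, c) = (if r = c then if r = 2 then 1 else if r = 0 then -1 else 0 else 0)"
  using assms carrier_matD[OF ketbra_carrier]
  by (auto simp: A1_def A2_def A3_def B_def C1_def C2_def C3_def ketbra_index)

lemma dissipator_carrier [simp]:
  assumes "L \<in> carrier_mat d d" "\<rho> \<in> carrier_mat d d"
  shows "dissipator L \<rho> \<in> carrier_mat d d"
  using mat_adjoint_carrier[OF assms(1)] assms unfolding dissipator_def anticomm_def
  by (intro minus_carrier_mat smult_carrier_mat add_carrier_mat mult_carrier_mat)

lemma dissipator_index:
  assumes L: "L \<in> carrier_mat d d" and \<rho>: "\<rho> \<in> carrier_mat d d" and ij: "i < d" "j < d"
  shows "dissipator L \<rho> $$ (i, j) =
    (\<Sum>k<d. \<Sum>l<d. L $$ (i, k) * \<rho> $$ (k, l) * cnj (L $$ (j, l)))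
    - 1/2 * ((\<Sum>k<d. (\<Sum>l<d. L $$ (i, l) * cnj (L $$ (k, l))) * \<rho> $$ (k, j))
           + (\<Sum>k<d. \<rho> $$ (i, k) * (\<Sum>l<d. L $$ (k, l) * cnj (L $$ (j, l)))))"
proof -
  let ?M = "L * mat_adjoint L"
  note A = mat_adjoint_carrier[OF L]
  note M = mult_carrier_mat[OF L A]
  have Mi: "?M $$ (r, c) = (\<Sum>l<d. L $$ (r, l) * cnj (L $$ (c, l)))" if "r < d" "c < d" for r c
    using L carrier_matD[OF A] that
    by (simp add: scalar_prod_def lessThan_atLeast0 mat_adjoint_index[OF L] cong: sum.cong_simp)
  have "(?M * \<rho>) $$ (i, j) = (\<Sum>k<d. ?M $$ (i, k) * \<rho> $$ (k, j))"
    and "(\<rho> * ?M) $$ (i, j) = (\<Sum>k<d. \<rho> $$ (i, k) * ?M $$ (k, j))"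
    using carrier_matD[OF M] carrier_matD[OF \<rho>] ij
    \<comment> \<open>Only the outer products are expanded, so that \<open>?M\<close> stays whole
      until \<open>Mi\<close> rewrites its entries.\<close>
    by (simp_all add: scalar_prod_def lessThan_atLeast0 del: index_mult_mat(1) cong: sum.cong_simp)
      (simp_all add: index_mult_mat(1)[of _ ?M] index_mult_mat(1)[of _ \<rho>] scalar_prod_def cong: sum.cong_simp)
  moreover have "dim_row (?M * \<rho>) = d" "dim_col (?M * \<rho>) = d" "dim_row (\<rho> * ?M) = d" "dim_col (\<rho> * ?M) = d"
    using L \<rho> carrier_matD[OF A] by auto
  ultimately show ?thesis
    using ij Mi unfolding dissipator_def anticomm_def
    by (simp add: conjugation_index[OF L \<rho>] del: index_mult_mat(1) cong: sum.cong_simp)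
qed

lemma PhiCF_carrier [simp]: "\<rho> \<in> carrier_mat 3 3 \<Longrightarrow> PhiCF \<beta> \<rho> \<in> carrier_mat 3 3"
  by (simp add: PhiCF_def PhiC_def S1_def S2_def S3_def minus_carrier_mat)

text \<open>The products L L^* sum to I, I and 2 I in \<open>S1\<close>, \<open>S2\<close> and
  \<open>S3\<close>, so each anticommutator part is a multiple of \<rho>. \<open>S1\<close> shifts
  the diagonal cyclically and subtracts \<rho>. \<open>S2\<close> and \<open>S3\<close> vanish on
  the diagonal and multiply the other entries by -1 and -3, so their difference multiplies these by
  2.\<close>

lemma PhiCF_index:
  assumes \<rho>: "\<rho> \<in> carrier_mat 3 3" and ij: "i < 3" "j < 3"
  shows "PhiCF \<beta> \<rho> $$ (i, j) = (if i = j then (\<rho> $$ (i, i) + \<rho> $$ ((i + 1) mod 3, (i + 1) mod 3)) / 2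
     else complex_of_real (1/2 - \<beta>) * \<rho> $$ (i, j))"
proof -
  have dim: "dim_row (dissipator L \<rho>) = 3" "dim_col (dissipator L \<rho>) = 3" if "L \<in> carrier_mat 3 3" for L
    using carrier_matD[OF dissipator_carrier[OF that \<rho>]] by auto
  have "i \<in> {0, 1, 2}" "j \<in> {0, 1, 2}" using ij by auto
  then show ?thesis
    using \<rho> by (auto simp: PhiCF_def PhiC_def S1_def S2_def S3_def dim dissipator_index[OF _ \<rho>]
        sum_lessThan_3 jump_operator_index field_simps
        simp flip: numeral_2_eq_2)
qed

text \<open>The identity term multiplies diagonal and off-diagonal entries by 1 and 1, the sum over
  the C_k by 2 and -1. Matching the multipliers 1/2 and 1/2 - \<beta> determines both weights; that
  of the identity is nonnegative exactly for \<beta> \<le> 3/4.\<close>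

lemma PhiCF_kraus:
  assumes \<rho>: "\<rho> \<in> carrier_mat 3 3"
  shows "PhiCF \<beta> \<rho> =
    complex_of_real (1/2) \<cdot>\<^sub>m (A1 * \<rho> * mat_adjoint A1 + A2 * \<rho> * mat_adjoint A2 + A3 * \<rho> * mat_adjoint A3)
    + complex_of_real (1/2 - 2 * \<beta> / 3) \<cdot>\<^sub>m (1\<^sub>m 3 * \<rho> * mat_adjoint (1\<^sub>m 3))
    + complex_of_real (\<beta> / 3) \<cdot>\<^sub>m (C1 * \<rho> * mat_adjoint C1 + C2 * \<rho> * mat_adjoint C2 + C3 * \<rho> * mat_adjoint C3)"
proof -
  define K where "K = (\<lambda>L. L * \<rho> * mat_adjoint L)"
  have fold_K: "L * \<rho> * mat_adjoint L = K L" for L by (simp add: K_def)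
  have dim: "dim_row (K L) = 3" "dim_col (K L) = 3" if "L \<in> carrier_mat 3 3" for L
    using linear_on_matricesD(1)[OF linear_on_conjugation[OF that] \<rho>] by (auto simp: K_def)
  have index: "K L $$ (i, j) = (\<Sum>k<3. \<Sum>l<3. L $$ (i, k) * \<rho> $$ (k, l) * cnj (L $$ (j, l)))"
    if "L \<in> carrier_mat 3 3" "i < 3" "j < 3" for L i j
    unfolding K_def using that by (intro conjugation_index \<rho>)
  show ?thesis
    unfolding fold_K
  proof (rule eq_matI, goal_cases)
    case (1 i j)
    then have "i < 3" "j < 3" by (simp_all add: dim)
    then have "i \<in> {0, 1, 2}" "j \<in> {0, 1, 2}" by auto
    then show ?case
      using \<rho> by (auto simp: PhiCF_index dim index sum_lessThan_3 jump_operator_index field_simps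
        simp flip: numeral_2_eq_2)
  qed (simp_all add: dim carrier_matD[OF PhiCF_carrier[OF \<rho>]])
qed

section \<open>Ranges of complete positivity and positivity\<close>

lemma completely_positive_PhiCF:
  assumes "0 \<le> \<beta>" "\<beta> \<le> 3/4"
  shows "completely_positive 3 (PhiCF \<beta>)"
  by (rule completely_positive_cong[OF _ PhiCF_kraus])
    (intro completely_positive_add completely_positive_smult completely_positive_conjugation;
      use assms in simp)

lemma psd_PhiCF_1:
  assumes \<rho>: "psd 3 \<rho>"
  shows "psd 3 (PhiCF 1 \<rho>)"
proof -
  have car: "\<rho> \<in> carrier_mat 3 3" using \<rho> by (simp add: psd_def)
  define r where "r = (\<lambda>i. Re (\<rho> $$ (i, i)))"
  \<comment> \<open>\<open>psd_minor\<close> speaks of two distinct indices, so some index other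
    than \<open>i\<close> is supplied.\<close>
  have nonneg: "0 \<le> \<rho> $$ (i, i)" if "i < 3" for i
    using psd_minor(2)[OF \<rho>, of i "if i = 0 then 1 else 0"] that by auto
  have diag: "\<rho> $$ (i, i) = complex_of_real (r i)" "0 \<le> r i" if "i < 3" for i
    using nonneg[OF that] by (auto simp: r_def less_eq_complex_def complex_eq_iff)
  have minor: "cmod (\<rho> $$ (i, j)) \<le> sqrt (r i) * sqrt (r j)" if "i < 3" "j < 3" "i \<noteq> j" for i j
    using psd_minor(1)[OF \<rho> that] by (simp add: r_def)
  have herm: "\<rho> $$ (j, i) = cnj (\<rho> $$ (i, j))" if "i < 3" "j < 3" for i j
    using \<rho> that by (simp add: psd_iff_sum)
  show ?thesis
    unfolding psd_iff_sum
  proof (intro conjI allI impI)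
    show "cnj (PhiCF 1 \<rho> $$ (j, i)) = PhiCF 1 \<rho> $$ (i, j)" if "i < 3" "j < 3" for i j
      using herm[OF that] that by (simp add: PhiCF_index[OF car] diag)
    fix f :: "nat \<Rightarrow> complex"
    define z where "z = (\<lambda>i j. \<rho> $$ (i, j) * f j * cnj (f i))"
    define N where "N = (r 0 + r 1) * (cmod (f 0))\<^sup>2 + (r 1 + r 2) * (cmod (f 1))\<^sup>2 + (r 2 + r 0) * (cmod (f 2))\<^sup>2"
    have offdiag: "z i j + z j i = complex_of_real (2 * Re (z i j))" if "i < 3" "j < 3" for i j
      using herm[OF that] by (simp add: z_def complex_eq_iff algebra_simps)
    have "(\<Sum>i<3. \<Sum>j<3. PhiCF 1 \<rho> $$ (i, j) * f j * cnj (f i)) =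
        ((r 0 + r 1) * (f 0 * cnj (f 0)) + (r 1 + r 2) * (f 1 * cnj (f 1)) + (r 2 + r 0) * (f 2 * cnj (f 2))
          - (z 0 1 + z 1 0) - (z 0 2 + z 2 0) - (z 1 2 + z 2 1)) / 2"
      by (simp add: sum_lessThan_3 PhiCF_index[OF car] diag z_def field_simps flip: numeral_2_eq_2)
    also have "\<dots> = complex_of_real ((N - 2 * Re (z 0 1) - 2 * Re (z 0 2) - 2 * Re (z 1 2)) / 2)"
      by (simp add: offdiag N_def complex_norm_square[symmetric])
    finally have form: "(\<Sum>i<3. \<Sum>j<3. PhiCF 1 \<rho> $$ (i, j) * f j * cnj (f i)) = \<dots>" .
    define x y where "x = (\<lambda>i. sqrt (r i))" and "y = (\<lambda>i. cmod (f i))"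
    \<comment> \<open>The off-diagonal multiplier at \<beta> = 1 is negative, so upper bounds on the
      real parts of the cross terms are what a lower bound on the form requires.\<close>
    have "Re (z i j) \<le> x i * x j * y i * y j" if "i < 3" "j < 3" "i \<noteq> j" for i j
    proof -
      have "Re (z i j) \<le> cmod (\<rho> $$ (i, j)) * (y i * y j)"
        using complex_Re_le_cmod[of "z i j"] by (simp add: z_def y_def norm_mult mult_ac)
      also have "\<dots> \<le> x i * x j * (y i * y j)"
        using minor[OF that] by (intro mult_right_mono) (auto simp: x_def y_def)
      finally show ?thesis by (simp add: mult_ac)
    qed
    from this[of 0 1] this[of 0 2] this[of 1 2]
    have "2 * Re (z 0 1) + 2 * Re (z 0 2) + 2 * Re (z 1 2)
        \<le> 2 * (x 0 * x 1 * y 0 * y 1 + x 0 * x 2 * y 0 * y 2 + x 1 * x 2 * y 1 * y 2)" by simp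
    also have "\<dots> \<le> ((x 0)\<^sup>2 + (x 1)\<^sup>2) * (y 0)\<^sup>2 + ((x 1)\<^sup>2 + (x 2)\<^sup>2) * (y 1)\<^sup>2 + ((x 2)\<^sup>2 + (x 0)\<^sup>2) * (y 2)\<^sup>2"
      using choi_form_ge_square[of "x 0" "y 0" "x 1" "y 1" "x 2" "y 2"]
      by (simp add: power2_eq_square algebra_simps)
    also have "\<dots> = N" using diag(2) by (simp add: N_def x_def y_def)
    finally show "0 \<le> (\<Sum>i<3. \<Sum>j<3. PhiCF 1 \<rho> $$ (i, j) * f j * cnj (f i))"
      unfolding form by (simp add: less_eq_complex_def)
  qed (use car in simp)
qed

text \<open>By \<open>PhiCF_index\<close> every entry is affine in \<beta>; the combination is
  convex for \<beta> between 0 and 1.\<close>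

lemma PhiCF_convex:
  assumes \<rho>: "\<rho> \<in> carrier_mat 3 3"
  shows "PhiCF \<beta> \<rho> = complex_of_real (1 - \<beta>) \<cdot>\<^sub>m PhiCF 0 \<rho> + complex_of_real \<beta> \<cdot>\<^sub>m PhiCF 1 \<rho>"
proof -
  note dim = carrier_matD[OF PhiCF_carrier[OF \<rho>]]
  show ?thesis
  proof (rule eq_matI, goal_cases)
    case (1 i j)
    then have "i < 3" "j < 3" by (simp_all add: dim)
    then show ?case by (simp add: dim PhiCF_index[OF \<rho>] algebra_simps)
  qed (simp_all add: dim)
qed

text \<open>The Kraus identity holds for every real \<beta>; linearity does not depend on the signs
  of its weights.\<close>

lemma linear_on_PhiCF: "linear_on_matrices 3 (PhiCF \<beta>)"
  by (rule linear_on_matrices_cong[OF _ PhiCF_kraus])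
    (intro linear_on_matrices_add linear_on_matrices_smult linear_on_conjugation; simp)

lemma positive_map_PhiCF:
  assumes "0 \<le> \<beta>" "\<beta> \<le> 1"
  shows "positive_map 3 (PhiCF \<beta>)"
  unfolding positive_map_def
proof (intro conjI allI impI linear_on_PhiCF)
  fix \<rho> assume \<rho>: "psd 3 \<rho>"
  have "psd 3 (PhiCF 0 \<rho>)"
    using completely_positive_imp_positive_map[OF completely_positive_PhiCF[of 0]] \<rho>
    by (simp add: positive_map_def)
  moreover have "\<rho> \<in> carrier_mat 3 3" using \<rho> by (simp add: psd_def)
  ultimately show "psd 3 (PhiCF \<beta> \<rho>)"
    unfolding PhiCF_convex[OF \<open>\<rho> \<in> carrier_mat 3 3\<close>, of \<beta>]
    using assms \<rho> by (intro psd_add psd_smult psd_PhiCF_1) simp_all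
qed

theorem mainTheorem7:
  shows "(\<forall>\<rho> \<in> carrier_mat 3 3. PhiCF 1 \<rho> = (1/2) \<cdot>\<^sub>m mat_of_rows_list 3
           [[entry \<rho> 1 1 + entry \<rho> 2 2, - entry \<rho> 1 2, - entry \<rho> 1 3],
            [- entry \<rho> 2 1, entry \<rho> 2 2 + entry \<rho> 3 3, - entry \<rho> 2 3],
            [- entry \<rho> 3 1, - entry \<rho> 3 2, entry \<rho> 3 3 + entry \<rho> 1 1]])
       \<and> (\<forall>\<beta>::real. 0 \<le> \<beta> \<and> \<beta> \<le> 1 \<longrightarrow> positive_map 3 (PhiCF \<beta>))
       \<and> (\<forall>\<beta>::real. 0 \<le> \<beta> \<and> \<beta> \<le> 3/4 \<longrightarrow> completely_positive 3 (PhiCF \<beta>))"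
proof (intro conjI ballI)
  fix \<rho> :: "complex mat" assume \<rho>: "\<rho> \<in> carrier_mat 3 3"
  show "PhiCF 1 \<rho> = (1/2) \<cdot>\<^sub>m mat_of_rows_list 3
           [[entry \<rho> 1 1 + entry \<rho> 2 2, - entry \<rho> 1 2, - entry \<rho> 1 3],
            [- entry \<rho> 2 1, entry \<rho> 2 2 + entry \<rho> 3 3, - entry \<rho> 2 3],
            [- entry \<rho> 3 1, - entry \<rho> 3 2, entry \<rho> 3 3 + entry \<rho> 1 1]]" (is "_ = ?R")
  proof (rule eq_matI, goal_cases)
    case (1 i j)
    then have ij: "i < 3" "j < 3" by (auto simp: mat_of_rows_list_def)
    then have "i \<in> {0, 1, 2}" "j \<in> {0, 1, 2}" by auto
    \<comment> \<open>The multiplier 1/2 - \<beta> is -1/2 here, whence the minus signs;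
      \<open>entry_eq\<close> passes from indices starting at 1 to those starting at 0.\<close>
    then show ?case
      using \<rho> by (auto simp: PhiCF_index mat_of_rows_list_def entry_eq simp flip: numeral_2_eq_2)
  qed (simp_all add: mat_of_rows_list_def carrier_matD[OF PhiCF_carrier[OF \<rho>]])
qed (use positive_map_PhiCF completely_positive_PhiCF in blast)+

end
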